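(* Let $\mathcal{V}=1516750$. For a real number $k>18$, let $\mathcal{W}(k)$ denote the solution $q>\mathcal{V}$ (with respect to the real variable $q$) of the equation $$\frac{\ln^2 q}{q}=\left(\frac{k-18}{0.302}\right)^3\frac{1}{k^5}.$$ Let $k>18$ be such that this solution exists and $\mathcal{W}(k)>\mathcal{V}$. Then for every prime power $q\ge\lceil\mathcal{W}(k)\rceil$, $$s_q(3,2)=\ell_q(4,3)\le\sqrt[3]{k\,q\ln q}+2.$$
   Context: $\ell_q(r,R)$ denotes the smallest length $n$ of a $q$-ary linear $[n,n-r]_q$ code (codimension $r$) with covering radius $R$. $s_q(3,2)$ denotes the smallest size of a $2$-saturating set in $\mathrm{PG}(3,q)$, where a point set $S\subset\mathrm{PG}(3,q)$ is $2$-saturating if every point of $\mathrm{PG}(3,q)$ lies in a plane spanned by three non-collinear points of $S$. (For $q>\mathcal{V}$ the function $\ln^2q/q$ is strictly decreasing, so the solution $\mathcal{W}(k)$ with $q>\mathcal{V}$ is unique when it exists.) *)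

theory Defs
  imports
    "HOL-Analysis.Analysis"
    "HOL-Library.Function_Algebras"
    "HOL-Number_Theory.Prime_Powers"
begin

section \<open>Linear codes over a finite field\<close>

text \<open>
  A word of length \<open>n\<close> is a sequence vanishing from index \<open>n\<close> on.  In this way the words of
  all lengths live in one vector space, and the length can be an ordinary natural number.
\<close>

interpretation wordvs: vector_space "\<lambda>(c :: 'a::field) (x :: nat \<Rightarrow> 'a) i. c * x i"
  by unfold_locales (auto simp: fun_eq_iff algebra_simps)

definition words :: "nat \<Rightarrow> (nat \<Rightarrow> 'a::field) set" where
  "words n = {x. \<forall>i\<ge>n. x i = 0}"

definition hamming_dist :: "nat \<Rightarrow> (nat \<Rightarrow> 'a::field) \<Rightarrow> (nat \<Rightarrow> 'a) \<Rightarrow> nat" where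
  "hamming_dist n x y = card {i. i < n \<and> x i \<noteq> y i}"

text \<open>\<open>linear_code n m C\<close>: \<open>C\<close> is an \<open>[n,m]\<close> code, i.e. of length \<open>n\<close> and dimension \<open>m\<close>.\<close>

definition linear_code :: "nat \<Rightarrow> nat \<Rightarrow> (nat \<Rightarrow> 'a::field) set \<Rightarrow> bool" where
  "linear_code n m C \<longleftrightarrow> C \<subseteq> words n \<and> wordvs.subspace C \<and> wordvs.dim C = m"

definition covering_radius :: "nat \<Rightarrow> (nat \<Rightarrow> 'a::field) set \<Rightarrow> nat" where
  "covering_radius n C = (LEAST R. \<forall>x\<in>words n. \<exists>c\<in>C. hamming_dist n x c \<le> R)"

text \<open>
  The length function \<open>\<ell>\<^sub>q(r,R)\<close>.  Here and below the field of order \<open>q\<close> is given by a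
  type \<open>'a\<close> with \<open>CARD('a) = q\<close>.  The guard \<open>r \<le> n\<close> keeps \<open>n - r\<close> from being truncated.
\<close>

definition length_function :: "'a::{field,finite} itself \<Rightarrow> nat \<Rightarrow> nat \<Rightarrow> nat" where
  "length_function _ r R =
     (LEAST n. r \<le> n \<and>
        (\<exists>C :: (nat \<Rightarrow> 'a) set. linear_code n (n - r) C \<and> covering_radius n C = R))"


section \<open>Saturating sets in \<open>PG(3,q)\<close>\<close>

text \<open>
  Subspaces of \<open>PG(3,q)\<close> of projective dimension \<open>m\<close> are the linear subspaces of
  \<open>F\<^sub>q\<^sup>4\<close> of dimension \<open>m + 1\<close>; incidence is inclusion.
\<close>

definition pg_subspaces :: "nat \<Rightarrow> ('a::field ^ 4) set set" where
  "pg_subspaces m = {U. vec.subspace U \<and> vec.dim U = m + 1}"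

abbreviation pg_points :: "('a::field ^ 4) set set" where
  "pg_points \<equiv> pg_subspaces 0"

abbreviation pg_lines :: "('a::field ^ 4) set set" where
  "pg_lines \<equiv> pg_subspaces 1"

definition collinear_points :: "('a::field ^ 4) set set \<Rightarrow> bool" where
  "collinear_points T \<longleftrightarrow> (\<exists>L\<in>pg_lines. \<forall>P\<in>T. P \<subseteq> L)"

text \<open>Non-collinear points \<open>A\<close>, \<open>B\<close>, \<open>C\<close> are automatically distinct.\<close>

definition two_saturating :: "('a::field ^ 4) set set \<Rightarrow> bool" where
  "two_saturating S \<longleftrightarrow> S \<subseteq> pg_points \<and>
     (\<forall>P\<in>pg_points. \<exists>A\<in>S. \<exists>B\<in>S. \<exists>C\<in>S.
        \<not> collinear_points {A, B, C} \<and> P \<subseteq> vec.span (A \<union> B \<union> C))"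

text \<open>The number \<open>s\<^sub>q(3,2)\<close>.\<close>

definition saturating_number :: "'a::{field,finite} itself \<Rightarrow> nat" where
  "saturating_number _ =
     (LEAST n. \<exists>S :: ('a ^ 4) set set. two_saturating S \<and> card S = n)"


section \<open>The threshold on \<open>q\<close>\<close>

definition \<V> :: real where
  "\<V> = 1516750"

definition \<W>_equation :: "real \<Rightarrow> real \<Rightarrow> bool" where
  "\<W>_equation k q \<longleftrightarrow> (ln q)\<^sup>2 / q = ((k - 18) / 0.302) ^ 3 * (1 / k ^ 5)"

text \<open>
  On \<open>q > \<V>\<close> the left-hand side of the equation is strictly decreasing, so the
  description below is proper as soon as a solution exists.
\<close>

definition \<W> :: "real \<Rightarrow> real" where
  "\<W> k = (THE q. q > \<V> \<and> \<W>_equation k q)"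

end

theory Submission
  imports Defs
begin

text \<open>
  A 2-saturating set is built greedily, as a set \<open>S\<close> of vectors of \<open>F\<^sub>q\<^sup>4\<close> any three of which are
  independent.  If \<open>v\<close> is not covered by \<open>S\<close> and \<open>card S = w\<close>, then the \<open>w choose 2\<close> spaces
  \<open>span {a, b, v}\<close> are pairwise distinct of dimension 3 and meet pairwise in dimension at most 2,
  so Bonferroni's inequality bounds from below the number of vectors whose addition to \<open>S\<close> covers
  \<open>v\<close>.  Averaging over all vectors, some choice multiplies the number of uncovered vectors by at
  most \<open>1 - w\<^sup>2/(2q) + w\<^sup>4/(8q\<^sup>2)\<close>, up to lower order terms.  After \<open>n\<close> steps, fewer than
  \<open>q\<^sup>4 exp (-(n\<^sup>3/(6q)) (1 - 0.15 n\<^sup>2/q))\<close> uncovered vectors remain, and with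
  \<open>n\<^sup>3 = k q ln q\<close> the condition \<open>q \<ge> \<W> k\<close> is equivalent to
  \<open>n\<^sup>3 (1 - 0.302 n\<^sup>2/q) \<ge> 18 q ln q\<close>; the gap between 0.15 and 0.302 absorbs all lower order
  terms.  The uncovered vectors come in classes of \<open>q - 1\<close> proportional ones, so
  fewer than \<open>q - 1\<close> means none.

  Saturating sets correspond to the columns of parity check matrices.  A code of codimension 4 and
  covering radius at most 2 has length at least \<open>q\<close>, hence the code of a smallest saturating set
  has covering radius exactly 3.
\<close>

section \<open>Subspaces over finite fields and the greedy construction\<close>

lemma (in vector_space) card_span_insert:
  assumes "a \<notin> span B"
  shows "card (span (insert a B)) = CARD('a) * card (span B)"
proof -
  let ?f = "\<lambda>(c, s). scale c a + s"
  have "span (insert a B) = ?f ` (UNIV \<times> span B)"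
  proof (intro equalityI subsetI)
    fix x assume "x \<in> span (insert a B)"
    then obtain c where "x - scale c a \<in> span B"
      by (auto simp: span_breakdown_eq)
    then show "x \<in> ?f ` (UNIV \<times> span B)"
      by (intro image_eqI[of _ _ "(c, x - scale c a)"]) auto
  next
    fix x assume "x \<in> ?f ` (UNIV \<times> span B)"
    then obtain c s where "x = scale c a + s" "s \<in> span B"
      by auto
    then show "x \<in> span (insert a B)"
      by (auto simp: span_breakdown_eq intro!: exI[of _ c])
  qed
  moreover have "inj_on ?f (UNIV \<times> span B)"
  proof (rule inj_onI, clarify)
    fix c s c' s' assume s: "s \<in> span B" "s' \<in> span B" and eq: "scale c a + s = scale c' a + s'"
    then have *: "scale (c - c') a = s' - s"
      by (simp add: scale_left_diff_distrib algebra_simps)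
    have "scale (c - c') a \<in> span B"
      unfolding * using s by (rule_tac span_diff)
    then have "scale (inverse (c - c')) (scale (c - c') a) \<in> span B"
      by (rule span_scale)
    then have "c = c'"
      using assms by (cases "c = c'") auto
    then show "c = c' \<and> s = s'"
      using eq by simp
  qed
  ultimately show ?thesis
    by (simp add: card_image card_cartesian_product)
qed

lemma (in vector_space) card_span:
  assumes "finite B" "independent B"
  shows "card (span B) = CARD('a) ^ card B"
  using assms
  by (induction B) (auto simp: independent_insert card_span_insert)

lemma (in vector_space) card_subspace:
  assumes "subspace V" "finite V"
  shows "card V = CARD('a) ^ dim V"
proof -
  obtain B where B: "B \<subseteq> V" "independent B" "V \<subseteq> span B" "card B = dim V"
    by (rule basis_exists)
  then have "span B = V"
    using assms by (metis span_minimal subset_antisym)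
  then show ?thesis
    using card_span[OF finite_subset[OF B(1) assms(2)] B(2)] B(4) by simp
qed

lemma card_vec_span:
  fixes T :: "('a::{field,finite} ^ 'n) set"
  shows "card (vec.span T) = CARD('a) ^ vec.dim T"
  using vec.card_subspace[of "vec.span T"] by simp

lemma card_vec_span_le:
  fixes T :: "('a::{field,finite} ^ 'n) set"
  shows "card (vec.span T) \<le> CARD('a) ^ card T"
  by (simp add: card_vec_span vec.dim_le_card' power_increasing)

text \<open>Second Bonferroni inequality, written additively to avoid truncated subtraction. Adding
  \<open>A x\<close> to the union loses at most \<open>card I * b\<close>, and
  \<open>Suc n choose 2 = n + (n choose 2)\<close> sums these losses.\<close>

lemma card_UN_Bonferroni:
  assumes "finite I" and "\<And>i. i \<in> I \<Longrightarrow> finite (A i)"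
    and "\<And>i j. i \<in> I \<Longrightarrow> j \<in> I \<Longrightarrow> i \<noteq> j \<Longrightarrow> card (A i \<inter> A j) \<le> b"
  shows "(\<Sum>i\<in>I. card (A i)) \<le> card (\<Union>i\<in>I. A i) + (card I choose 2) * b"
  using assms
proof (induction I)
  case (insert x I)
  have "card (A x \<inter> (\<Union>i\<in>I. A i)) \<le> (\<Sum>i\<in>I. card (A x \<inter> A i))"
    unfolding Int_UN_distrib using insert.hyps(1) by (rule card_UN_le)
  also have "\<dots> \<le> card I * b"
    using insert by (intro order.trans[OF sum_bounded_above[of I _ b]]) auto
  finally have "card (A x) + card (\<Union>i\<in>I. A i) \<le> card (A x \<union> (\<Union>i\<in>I. A i)) + card I * b"
    using insert by (subst card_Un_Int) auto
  moreover have "(\<Sum>i\<in>I. card (A i)) \<le> card (\<Union>i\<in>I. A i) + (card I choose 2) * b"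
    using insert by auto
  moreover have "Suc (card I) choose 2 = card I + (card I choose 2)"
    by (simp add: numeral_2_eq_2)
  ultimately show ?case
    using insert.hyps by (simp add: algebra_simps)
qed simp

section \<open>Greedy growth of a cap\<close>

text \<open>Such vectors represent a cap of the projective space: they are nonzero, pairwise
  non-proportional, and no three of their points are collinear.\<close>

definition any_three_independent :: "('a::field ^ 4) set \<Rightarrow> bool" where
  "any_three_independent S \<longleftrightarrow> (\<forall>T\<subseteq>S. card T \<le> 3 \<longrightarrow> vec.independent T)"

text \<open>Taking \<open>T = {}\<close> shows that the zero vector always counts as
  covered.\<close>

definition uncovered :: "('a::field ^ 4) set \<Rightarrow> ('a ^ 4) set" where
  "uncovered S = {v. \<forall>T\<subseteq>S. card T \<le> 3 \<longrightarrow> v \<notin> vec.span T}"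

definition pairs :: "'b set \<Rightarrow> 'b set set" where
  "pairs S = {p. p \<subseteq> S \<and> card p = 2}"

text \<open>Candidates \<open>u\<close> whose addition covers \<open>v\<close>. The spans of all
  pairs are removed, not only that of the pair used for \<open>v\<close>, so that adding
  \<open>u\<close> also keeps any three vectors independent.\<close>

definition gain :: "('a::field ^ 4) set \<Rightarrow> 'a ^ 4 \<Rightarrow> ('a ^ 4) set" where
  "gain S v = (\<Union>p\<in>pairs S. vec.span (insert v p)) - (\<Union>p\<in>pairs S. vec.span p)"

text \<open>Bonferroni for the 3-dimensional spaces \<open>span (insert v p)\<close>. Of the two
  error terms, the first bounds their pairwise intersections and the second the removed spans of
  pairs.\<close>

lemma card_gain:
  fixes S :: "('a::{field,finite} ^ 4) set"
  assumes S: "any_three_independent S" and v: "v \<in> uncovered S"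
  defines "q \<equiv> CARD('a)" and "m \<equiv> card S choose 2"
  shows "m * q ^ 3 \<le> card (gain S v) + (m choose 2) * q ^ 2 + m * q ^ 2"
proof -
  have card_pairs: "card (pairs S) = m"
    unfolding pairs_def m_def by (simp add: n_subsets)
  have ind: "vec.independent (insert v p)" "v \<notin> p" if "p \<in> pairs S" for p
  proof -
    have p: "p \<subseteq> S" "card p \<le> 3"
      using that by (auto simp: pairs_def)
    then have "v \<notin> vec.span p" "vec.independent p"
      using S v by (auto simp: any_three_independent_def uncovered_def)
    then show "vec.independent (insert v p)" "v \<notin> p"
      by (auto simp: vec.independent_insert dest: vec.span_base)
  qed
  have card3: "card (insert v p) = 3" if "p \<in> pairs S" for p
    using ind[OF that] that by (auto simp: pairs_def)
  have c3: "card (vec.span (insert v p)) = q ^ 3" if "p \<in> pairs S" for p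
    using ind[OF that] card3[OF that] by (simp add: vec.card_span q_def)
  have c2: "card (vec.span (insert v p) \<inter> vec.span (insert v p')) \<le> q ^ 2"
    if p: "p \<in> pairs S" "p' \<in> pairs S" "p \<noteq> p'" for p p'
  proof -
    have "\<not> p' \<subseteq> p"
      using p by (metis (mono_tags, lifting) card_subset_eq finite mem_Collect_eq pairs_def)
    then obtain c where c: "c \<in> p'" "c \<notin> p"
      by auto
    have cp: "insert c p \<subseteq> S" "card (insert c p) = 3"
      using c p by (auto simp: pairs_def)
    then have "vec.independent (insert c p)"
      using S by (simp add: any_three_independent_def)
    then have "c \<notin> vec.span p"
      using c by (simp add: vec.independent_insert)
    moreover have "v \<notin> vec.span (insert c p)"
      using cp v by (auto simp: uncovered_def)
    \<comment> \<open>Exchange: otherwise \<open>v\<close> would lie in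
      \<open>span (insert c p)\<close>, which is spanned by three vectors of
      \<open>S\<close>.\<close>
    ultimately have "c \<notin> vec.span (insert v p)"
      using vec.in_span_insert by blast
    moreover have "c \<in> vec.span (insert v p')"
      using c by (simp add: vec.span_base)
    ultimately have ne: "vec.span (insert v p) \<inter> vec.span (insert v p') \<noteq> vec.span (insert v p')"
      by auto
    let ?U = "vec.span (insert v p) \<inter> vec.span (insert v p')"
    have sub: "vec.subspace ?U"
      by (simp add: vec.subspace_inter)
    have "vec.span ?U = ?U"
      using sub by (simp only: vec.span_eq_iff)
    then have "vec.span ?U \<subset> vec.span (insert v p')"
      using ne by (simp only: psubset_eq) blast
    then have "vec.dim ?U < vec.dim (insert v p')"
      by (rule vec.dim_psubset)
    also have "\<dots> \<le> 3"
      using vec.dim_le_card'[of "insert v p'"] card3[OF p(2)] by simp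
    finally show ?thesis
      using vec.card_subspace[OF sub] by (simp add: q_def power_increasing)
  qed
  have "m * q ^ 3 = (\<Sum>p\<in>pairs S. card (vec.span (insert v p)))"
    by (simp add: c3 card_pairs)
  also have "\<dots> \<le> card (\<Union>p\<in>pairs S. vec.span (insert v p)) + (m choose 2) * q ^ 2"
    unfolding card_pairs[symmetric]
    by (rule card_UN_Bonferroni) (auto intro: c2)
  also have "card (\<Union>p\<in>pairs S. vec.span (insert v p))
      \<le> card (gain S v) + card (\<Union>p\<in>pairs S. vec.span p)"
    unfolding gain_def by (rule order.trans[OF _ card_Un_le]) (auto intro!: card_mono)
  also have "card (\<Union>p\<in>pairs S. vec.span p) \<le> (\<Sum>p\<in>pairs S. card (vec.span p))"
    by (simp add: card_UN_le)
  also have "\<dots> \<le> m * q ^ 2"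
    unfolding card_pairs[symmetric] q_def
    by (intro order.trans[OF sum_bounded_above[of _ _ "CARD('a) ^ 2"]])
      (auto simp: pairs_def intro: order.trans[OF card_vec_span_le])
  finally show ?thesis
    by simp
qed

lemma any_three_independent_insert:
  fixes S :: "('a::{field,finite} ^ 4) set"
  assumes S: "any_three_independent S" "2 \<le> card S" and u: "u \<in> gain S v"
  shows "any_three_independent (insert u S)"
  unfolding any_three_independent_def
proof (intro allI impI)
  fix T assume T: "T \<subseteq> insert u S" "card T \<le> 3"
  show "vec.independent T"
  proof (cases "u \<in> T")
    case True
    then have T': "T - {u} \<subseteq> S" "card (T - {u}) \<le> 2"
      using T by auto
    \<comment> \<open>At most two vectors of \<open>T\<close> differ from \<open>u\<close>; padding
      them to a full pair of \<open>S\<close> is where \<open>2 \<le> card S\<close> enters.\<close>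
    obtain p where p: "T - {u} \<subseteq> p" "p \<subseteq> S" "card p = 2"
      using exists_subset_between[of "T - {u}" 2 S] T' S by auto
    have "u \<notin> vec.span p"
      using u p by (auto simp: gain_def pairs_def)
    then have "u \<notin> vec.span (T - {u})"
      using p vec.span_mono by blast
    moreover have "vec.independent (T - {u})"
      using S T' by (auto simp: any_three_independent_def)
    ultimately show ?thesis
      using True vec.independent_insertI[of u "T - {u}"] by (simp add: insert_absorb)
  qed (use T S in \<open>auto simp: any_three_independent_def\<close>)
qed

text \<open>By exchange \<open>v\<close> lies in \<open>span (insert u p)\<close> for some pair
  \<open>p\<close>. If \<open>u\<close> were already in \<open>S\<close>, the same span would show
  that \<open>v\<close> was covered before.\<close>

lemma gain_covers:
  fixes S :: "('a::{field,finite} ^ 4) set"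
  assumes v: "v \<in> uncovered S" and u: "u \<in> gain S v"
  shows "v \<notin> uncovered (insert u S)" "u \<notin> S"
proof -
  obtain p where p: "p \<subseteq> S" "card p = 2" "u \<in> vec.span (insert v p)" "u \<notin> vec.span p"
    using u by (auto simp: gain_def pairs_def)
  then have "v \<in> vec.span (insert u p)"
    by (blast intro: vec.in_span_insert)
  moreover have "card (insert u p) \<le> 3"
    using p by (simp add: card_insert_if)
  ultimately show "v \<notin> uncovered (insert u S)"
    using p by (auto simp: uncovered_def intro!: exI[of _ "insert u p"])
  show "u \<notin> S"
  proof
    assume "u \<in> S"
    then have "insert u p \<subseteq> S" using p by auto
    with \<open>v \<in> vec.span (insert u p)\<close> \<open>card (insert u p) \<le> 3\<close> v show False
      by (auto simp: uncovered_def)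
  qed
qed

text \<open>Double counting of the incidences \<open>u \<in> G v\<close>: some \<open>u\<close>
  reaches the average over the whole type.\<close>

lemma exists_popular_element:
  fixes G :: "'b \<Rightarrow> 'c::finite set" and g :: real
  assumes "finite U" and "\<And>v. v \<in> U \<Longrightarrow> g \<le> card (G v)"
  shows "\<exists>u. card U * g \<le> CARD('c) * card {v \<in> U. u \<in> G v}"
proof (rule ccontr)
  assume "\<not> ?thesis"
  then have less: "CARD('c) * real (card {v \<in> U. u \<in> G v}) < card U * g" for u
    by (auto simp: not_le)
  have "(\<Sum>u\<in>UNIV. card {v \<in> U. u \<in> G v}) = (\<Sum>u\<in>UNIV. \<Sum>v\<in>U. of_bool (u \<in> G v))"
    using assms(1) by (simp add: Int_def)
  also have "\<dots> = (\<Sum>v\<in>U. card (G v))"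
    by (subst sum.swap) simp
  finally have sw: "(\<Sum>u\<in>UNIV. card {v \<in> U. u \<in> G v}) = (\<Sum>v\<in>U. card (G v))" .
  have "(\<Sum>u\<in>(UNIV::'c set). CARD('c) * real (card {v \<in> U. u \<in> G v})) < (\<Sum>u\<in>(UNIV::'c set). card U * g)"
    using less by (intro sum_strict_mono) auto
  also have "\<dots> = CARD('c) * (\<Sum>v\<in>U. g)"
    by simp
  also have "\<dots> \<le> CARD('c) * (\<Sum>v\<in>U. real (card (G v)))"
    using assms(2) by (intro mult_left_mono sum_mono) auto
  also have "\<dots> = CARD('c) * real (\<Sum>u\<in>UNIV. card {v \<in> U. u \<in> G v})"
    unfolding sw by simp
  finally show False
    by (simp add: sum_distrib_left)
qed

text \<open>The lower bound of \<open>card_gain\<close> for a set of size \<open>w\<close>, divided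
  by the number \<open>q ^ 4\<close> of all vectors.\<close>

definition rate :: "real \<Rightarrow> nat \<Rightarrow> real" where
  "rate q w = (real (w choose 2) * (q - 1) - real ((w choose 2) choose 2)) / q\<^sup>2"

lemma greedy_step:
  fixes S :: "('a::{field,finite} ^ 4) set"
  assumes S: "any_three_independent S" "2 \<le> card S" and ne: "uncovered S \<noteq> {}"
    and pos: "0 < rate CARD('a) (card S)"
  shows "\<exists>u. u \<notin> S \<and> any_three_independent (insert u S) \<and>
    card (uncovered (insert u S)) \<le> card (uncovered S) * (1 - rate CARD('a) (card S))"
proof -
  define q where "q = real CARD('a)"
  have q: "q > 0"
    by (simp add: q_def)
  let ?r = "rate q (card S)" and ?m = "card S choose 2"
  have "?r * q ^ 4 \<le> card (gain S v)" if "v \<in> uncovered S" for v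
  proof -
    have "real (?m * CARD('a) ^ 3) \<le> real (card (gain S v) + (?m choose 2) * CARD('a) ^ 2 + ?m * CARD('a) ^ 2)"
      using card_gain[OF S(1) that] by (simp only: of_nat_le_iff)
    moreover have "?r * q ^ 4 = ?m * q ^ 3 - ?m * q\<^sup>2 - (?m choose 2) * q\<^sup>2"
      using q by (simp add: rate_def field_simps power_numeral_reduce)
    ultimately show ?thesis
      by (simp add: q_def)
  qed
  then obtain u where "card (uncovered S) * (?r * q ^ 4)
      \<le> CARD('a ^ 4) * card {v \<in> uncovered S. u \<in> gain S v}"
    using exists_popular_element[of "uncovered S" "?r * q ^ 4" "gain S"] by auto
  then have "q ^ 4 * (card (uncovered S) * ?r) \<le> q ^ 4 * card {v \<in> uncovered S. u \<in> gain S v}"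
    by (simp add: q_def mult_ac)
  then have *: "card (uncovered S) * ?r \<le> card {v \<in> uncovered S. u \<in> gain S v}"
    using q by simp
  \<comment> \<open>Positivity of the rate provides at least one \<open>v\<close> with
    \<open>u \<in> gain S v\<close>; this single \<open>v\<close> already yields
    \<open>u \<notin> S\<close> and the independence of triples in
    \<open>insert u S\<close>.\<close>
  have "0 < card (uncovered S) * ?r"
    using ne pos by (simp add: card_gt_0_iff q_def)
  with * have "card {v \<in> uncovered S. u \<in> gain S v} \<noteq> 0"
    by linarith
  then have "{v \<in> uncovered S. u \<in> gain S v} \<noteq> {}"
    by (simp only: card_eq_0_iff) blast
  then obtain v where v: "v \<in> uncovered S" "u \<in> gain S v"
    by blast
  have "uncovered (insert u S) \<subseteq> uncovered S - {v \<in> uncovered S. u \<in> gain S v}"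
    using gain_covers(1)[of _ S u] by (auto simp: uncovered_def)
  then have "card (uncovered (insert u S)) \<le> card (uncovered S - {v \<in> uncovered S. u \<in> gain S v})"
    by (simp add: card_mono)
  also have "\<dots> = card (uncovered S) - card {v \<in> uncovered S. u \<in> gain S v}"
    by (simp add: card_Diff_subset)
  finally have "card (uncovered (insert u S)) + card {v \<in> uncovered S. u \<in> gain S v}
      \<le> card (uncovered S)"
    using card_mono[of "uncovered S" "{v \<in> uncovered S. u \<in> gain S v}"] by (auto simp: le_diff_conv2)
  then have "real (card (uncovered (insert u S)))
      \<le> real (card (uncovered S)) - card {v \<in> uncovered S. u \<in> gain S v}"
    by linarith
  then show ?thesis
    using gain_covers(2)[OF v] any_three_independent_insert[OF S v(2)] *
    by (intro exI[of _ u]) (simp add: q_def right_diff_distrib)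
qed

text \<open>Either everything is covered early and the construction stops, or the set grows to size
  exactly \<open>N\<close>. The factors \<open>1 - rate\<close> are bounded by
  \<open>exp (- rate)\<close>, which turns their product into a sum.\<close>

lemma greedy:
  assumes rate: "\<And>j. 4 \<le> j \<Longrightarrow> j < N \<Longrightarrow> 0 < rate CARD('a) j" and "4 \<le> N"
  shows "\<exists>S :: ('a::{field,finite} ^ 4) set. card S \<le> N \<and>
    (uncovered S = {} \<or>
     4 \<le> card S \<and> any_three_independent S \<and> card S = N \<and>
     card (uncovered S) \<le> CARD('a) ^ 4 * exp (- (\<Sum>j=4..<N. rate CARD('a) j)))"
  using \<open>4 \<le> N\<close> rate
proof (induction N rule: dec_induct)
  case base
  \<comment> \<open>The four unit vectors start the construction, with the trivial bound
    \<open>CARD('a) ^ 4\<close> on the uncovered vectors; hence the sum of rates begins at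
    4.\<close>
  have "any_three_independent (cart_basis :: ('a ^ 4) set)"
    using vec.independent_mono[OF independent_cart_basis] by (auto simp: any_three_independent_def)
  moreover have "card (uncovered (cart_basis :: ('a ^ 4) set)) \<le> CARD('a ^ 4)"
    by (intro card_mono) auto
  then have "real (card (uncovered (cart_basis :: ('a ^ 4) set))) \<le> real (CARD('a) ^ 4)"
    unfolding of_nat_le_iff by simp
  ultimately show ?case
    by (intro exI[of _ cart_basis]) (auto simp: card_cart_basis)
next
  case (step N)
  then obtain S :: "('a ^ 4) set" where S: "card S \<le> N" "uncovered S = {} \<or>
     4 \<le> card S \<and> any_three_independent S \<and> card S = N \<and>
     card (uncovered S) \<le> CARD('a) ^ 4 * exp (- (\<Sum>j=4..<N. rate CARD('a) j))"
    by auto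
  show ?case
  proof (cases "uncovered S = {}")
    case True
    then show ?thesis
      using S by (intro exI[of _ S]) auto
  next
    case False
    let ?r = "rate CARD('a) N"
    from False S have S': "any_three_independent S" "card S = N"
      "card (uncovered S) \<le> CARD('a) ^ 4 * exp (- (\<Sum>j=4..<N. rate CARD('a) j))"
      by auto
    then obtain u where u: "u \<notin> S" "any_three_independent (insert u S)"
      "card (uncovered (insert u S)) \<le> card (uncovered S) * (1 - ?r)"
      using greedy_step[of S] False step.hyps step.prems[of N] by auto
    note u(3)
    also have "card (uncovered S) * (1 - ?r) \<le> card (uncovered S) * exp (- ?r)"
      using exp_ge_add_one_self[of "- ?r"] by (intro mult_left_mono) auto
    also have "\<dots> \<le> CARD('a) ^ 4 * exp (- (\<Sum>j=4..<N. rate CARD('a) j)) * exp (- ?r)"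
      using S' by (intro mult_right_mono) auto
    also have "\<dots> = CARD('a) ^ 4 * exp (- (\<Sum>j=4..<Suc N. rate CARD('a) j))"
      using step.hyps by (simp add: exp_diff exp_minus divide_inverse)
    finally show ?thesis
      using u S' step by (intro exI[of _ "insert u S"]) auto
  qed
qed

lemma uncovered_scale_iff:
  assumes "c \<noteq> 0"
  shows "c *s v \<in> uncovered S \<longleftrightarrow> v \<in> uncovered S"
proof -
  have "c *s v \<in> vec.span T \<longleftrightarrow> v \<in> vec.span T" for T
    using vec.span_scale[of v T c] vec.span_scale[of "c *s v" T "inverse c"] assms by auto
  then show ?thesis
    by (simp add: uncovered_def)
qed

lemma card_uncovered_ge:
  fixes S :: "('a::{field,finite} ^ 4) set"
  assumes "uncovered S \<noteq> {}"
  shows "CARD('a) - 1 \<le> card (uncovered S)"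
proof -
  obtain v where v: "v \<in> uncovered S"
    using assms by auto
  \<comment> \<open>That is, \<open>v\<close> is nonzero, so its multiples are distinct.\<close>
  have "v \<notin> vec.span {}"
    using v by (auto simp: uncovered_def simp del: vec.span_empty)
  then have "inj (\<lambda>c. c *s v)"
    by (intro injI) (simp add: vec.scale_cancel_right)
  then have "card ((\<lambda>c. c *s v) ` (UNIV - {0})) = card (UNIV - {0::'a})"
    by (rule card_image[OF inj_on_subset]) auto
  moreover have "(\<lambda>c. c *s v) ` (UNIV - {0}) \<subseteq> uncovered S"
    using v uncovered_scale_iff by auto
  ultimately show ?thesis
    using card_mono[of "uncovered S" "(\<lambda>c. c *s v) ` (UNIV - {0})"] by simp
qed


section \<open>Codes and saturating sets\<close>

text \<open>Here \<open>h\<close> lists the columns of a parity check matrix with 4 rows. Sets of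
  indices are used rather than sets of vectors, since columns may repeat.\<close>

definition columns_cover :: "(nat \<Rightarrow> 'a::field ^ 4) \<Rightarrow> nat \<Rightarrow> nat \<Rightarrow> bool" where
  "columns_cover h n R \<longleftrightarrow> (\<forall>v. \<exists>I\<subseteq>{..<n}. card I \<le> R \<and> v \<in> vec.span (h ` I))"

definition syndrome :: "(nat \<Rightarrow> 'a::field ^ 4) \<Rightarrow> nat \<Rightarrow> (nat \<Rightarrow> 'a) \<Rightarrow> 'a ^ 4" where
  "syndrome h n x = (\<Sum>i<n. x i *s h i)"

definition kernel_code :: "(nat \<Rightarrow> 'a::field ^ 4) \<Rightarrow> nat \<Rightarrow> (nat \<Rightarrow> 'a) set" where
  "kernel_code h n = {x \<in> words n. syndrome h n x = 0}"

lemma syndrome_simps: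
  "syndrome h n (\<lambda>i. 0) = 0"
  "syndrome h n 0 = 0"
  "syndrome h n (x + y) = syndrome h n x + syndrome h n y"
  "syndrome h n (x - y) = syndrome h n x - syndrome h n y"
  "syndrome h n (\<lambda>i. c * x i) = c *s syndrome h n x"
proof -
  show "syndrome h n (\<lambda>i. 0) = 0" "syndrome h n 0 = 0"
    by (simp_all add: syndrome_def)
  show "syndrome h n (x + y) = syndrome h n x + syndrome h n y"
    by (simp add: syndrome_def vec.scale_left_distrib sum.distrib)
  show "syndrome h n (x - y) = syndrome h n x - syndrome h n y"
    by (simp add: syndrome_def vec.scale_left_diff_distrib sum_subtractf)
  show "syndrome h n (\<lambda>i. c * x i) = c *s syndrome h n x"
    unfolding syndrome_def vec.scale_sum_right vec.scale_scale ..
qed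

lemma subspace_words: "wordvs.subspace (words n)"
  by (rule wordvs.subspaceI) (auto simp: words_def)

lemma subspace_kernel_code: "wordvs.subspace (kernel_code h n)"
  by (rule wordvs.subspaceI) (auto simp: words_def kernel_code_def syndrome_simps)

text \<open>Extensional functions are \<open>undefined\<close> beyond \<open>n\<close> where words
  are 0; resetting that value transfers finiteness and cardinality from \<open>PiE\<close>.\<close>

lemma words_eq_PiE_image:
  "words n = (\<lambda>f i. if i < n then f i else 0) ` ({..<n} \<rightarrow>\<^sub>E UNIV)"
proof (intro equalityI subsetI)
  fix x :: "nat \<Rightarrow> 'a" assume x: "x \<in> words n"
  show "x \<in> (\<lambda>f i. if i < n then f i else 0) ` ({..<n} \<rightarrow>\<^sub>E UNIV)"
  proof (rule_tac image_eqI[of _ _ "restrict x {..<n}"])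
    show "x = (\<lambda>i. if i < n then restrict x {..<n} i else 0)"
      using x by (simp add: words_def fun_eq_iff not_less)
  qed simp
next
  fix x :: "nat \<Rightarrow> 'a"
  assume "x \<in> (\<lambda>f i. if i < n then f i else 0) ` ({..<n} \<rightarrow>\<^sub>E UNIV)"
  then obtain f where "x = (\<lambda>i. if i < n then f i else 0)" ..
  then show "x \<in> words n"
    by (simp add: words_def)
qed

lemma finite_words: "finite (words n :: (nat \<Rightarrow> 'a::{field,finite}) set)"
  unfolding words_eq_PiE_image by (intro finite_imageI finite_PiE) auto

lemma card_words: "card (words n :: (nat \<Rightarrow> 'a::{field,finite}) set) = CARD('a) ^ n"
proof -
  have inj: "inj_on (\<lambda>f i. if i < n then f i else 0) ({..<n} \<rightarrow>\<^sub>E (UNIV :: 'a set))"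
  proof (rule inj_onI, rule ext)
    fix f g i
    assume f: "f \<in> {..<n} \<rightarrow>\<^sub>E (UNIV :: 'a set)" and g: "g \<in> {..<n} \<rightarrow>\<^sub>E (UNIV :: 'a set)"
      and eq: "(\<lambda>i. if i < n then f i else 0) = (\<lambda>i. if i < n then g i else 0)"
    show "f i = g i"
    proof (cases "i < n")
      case True
      then show ?thesis using fun_cong[OF eq, of i] by simp
    next
      case False
      then have "i \<notin> {..<n}"
        by simp
      then show ?thesis
        using PiE_arb[OF f, of i] PiE_arb[OF g, of i] by simp
    qed
  qed
  show ?thesis
    unfolding words_eq_PiE_image card_image[OF inj] by (simp add: card_PiE)
qed

text \<open>The syndromes of words supported in \<open>I\<close> form a subspace that contains the
  columns indexed by \<open>I\<close>, and each such syndrome is a combination of these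
  columns.\<close>

lemma span_columns_iff:
  assumes "I \<subseteq> {..<n}"
  shows "v \<in> vec.span (h ` I) \<longleftrightarrow> (\<exists>x. {i. x i \<noteq> 0} \<subseteq> I \<and> syndrome h n x = v)"
proof
  let ?W = "{syndrome h n x | x. {i. x i \<noteq> 0} \<subseteq> I}"
  have "h ` I \<subseteq> ?W"
  proof clarify
    fix i assume i: "i \<in> I"
    have "syndrome h n (\<lambda>j. if j = i then 1 else 0) = (\<Sum>j<n. if j = i then h i else 0)"
      unfolding syndrome_def by (intro sum.cong) auto
    also have "\<dots> = h i"
      using i assms by auto
    finally show "\<exists>x. h i = syndrome h n x \<and> {i. x i \<noteq> 0} \<subseteq> I"
      using i by (intro exI[of _ "\<lambda>j. if j = i then 1 else 0"]) auto
  qed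
  moreover have "vec.subspace ?W"
  proof (rule vec.subspaceI)
    show "0 \<in> ?W"
      using syndrome_simps(1) by (auto intro!: exI[of _ "\<lambda>i. 0"])
  next
    fix v w assume "v \<in> ?W" "w \<in> ?W"
    then obtain x y where "{i. x i \<noteq> 0} \<subseteq> I" "v = syndrome h n x"
        "{i. y i \<noteq> 0} \<subseteq> I" "w = syndrome h n y"
      by auto
    then have "{i. (x + y) i \<noteq> 0} \<subseteq> I" "v + w = syndrome h n (x + y)"
      by (auto simp: syndrome_simps subset_iff) (metis add.right_neutral)
    then show "v + w \<in> ?W"
      by blast
  next
    fix c v assume "v \<in> ?W"
    then obtain x where "{i. x i \<noteq> 0} \<subseteq> I" "v = syndrome h n x"
      by auto
    then show "c *s v \<in> ?W"
      by (auto simp: syndrome_simps intro!: exI[of _ "\<lambda>i. c * x i"])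
  qed
  ultimately have "vec.span (h ` I) \<subseteq> ?W"
    by (rule vec.span_minimal)
  then show "v \<in> vec.span (h ` I) \<Longrightarrow> \<exists>x. {i. x i \<noteq> 0} \<subseteq> I \<and> syndrome h n x = v"
    by blast
next
  assume "\<exists>x. {i. x i \<noteq> 0} \<subseteq> I \<and> syndrome h n x = v"
  then obtain x where x: "{i. x i \<noteq> 0} \<subseteq> I" "syndrome h n x = v"
    by auto
  have "x i *s h i \<in> vec.span (h ` I)" for i
  proof (cases "x i = 0")
    case False
    with x have "i \<in> I" by auto
    then show ?thesis by (simp add: vec.span_base vec.span_scale)
  qed (simp add: vec.span_zero)
  then show "v \<in> vec.span (h ` I)"
    unfolding x(2)[symmetric] syndrome_def by (intro vec.span_sum)
qed

lemma words_support: "{i. x i \<noteq> 0} \<subseteq> I \<Longrightarrow> I \<subseteq> {..<n} \<Longrightarrow> x \<in> words n"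
  by (force simp: words_def)

lemma columns_cover_imp_surj:
  assumes "columns_cover h n R"
  shows "syndrome h n ` words n = UNIV"
proof -
  have "v \<in> syndrome h n ` words n" for v
  proof -
    obtain I where I: "I \<subseteq> {..<n}" "v \<in> vec.span (h ` I)"
      using assms by (auto simp: columns_cover_def)
    then obtain x where "{i. x i \<noteq> 0} \<subseteq> I" "syndrome h n x = v"
      by (auto simp: span_columns_iff)
    then show ?thesis
      using words_support[of x I n] I by auto
  qed
  then show ?thesis by auto
qed

text \<open>A codeword \<open>c\<close> near \<open>x\<close> corresponds to the error
  \<open>x - c\<close>, which has the syndrome of \<open>x\<close> and is supported where the two
  differ; conversely an error \<open>e\<close> with that syndrome gives the codeword
  \<open>x - e\<close>.\<close>

lemma kernel_covering_iff:
  fixes h :: "nat \<Rightarrow> 'a::field ^ 4"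
  assumes surj: "syndrome h n ` words n = UNIV"
  shows "(\<forall>x\<in>words n. \<exists>c\<in>kernel_code h n. hamming_dist n x c \<le> R) \<longleftrightarrow> columns_cover h n R"
proof
  assume L: "\<forall>x\<in>words n. \<exists>c\<in>kernel_code h n. hamming_dist n x c \<le> R"
  show "columns_cover h n R"
    unfolding columns_cover_def
  proof
    fix v :: "'a ^ 4"
    obtain x where x: "x \<in> words n" "syndrome h n x = v"
      using surj by (metis UNIV_I imageE)
    then obtain c where c: "c \<in> kernel_code h n" "hamming_dist n x c \<le> R"
      using L by auto
    have "{i. (x - c) i \<noteq> 0} \<subseteq> {i. i < n \<and> x i \<noteq> c i}"
      using x c by (auto simp: words_def kernel_code_def) (metis not_le)
    moreover have "syndrome h n (x - c) = v"
      using x c by (simp add: syndrome_simps kernel_code_def)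
    ultimately have "v \<in> vec.span (h ` {i. i < n \<and> x i \<noteq> c i})"
      by (subst span_columns_iff[where n = n]) blast+
    then show "\<exists>I\<subseteq>{..<n}. card I \<le> R \<and> v \<in> vec.span (h ` I)"
      using c by (intro exI[of _ "{i. i < n \<and> x i \<noteq> c i}"]) (auto simp: hamming_dist_def)
  qed
next
  assume R: "columns_cover h n R"
  show "\<forall>x\<in>words n. \<exists>c\<in>kernel_code h n. hamming_dist n x c \<le> R"
  proof
    fix x :: "nat \<Rightarrow> 'a" assume x: "x \<in> words n"
    obtain I where I: "I \<subseteq> {..<n}" "card I \<le> R" "syndrome h n x \<in> vec.span (h ` I)"
      using R by (auto simp: columns_cover_def)
    then obtain e where e: "{i. e i \<noteq> 0} \<subseteq> I" "syndrome h n e = syndrome h n x"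
      by (auto simp: span_columns_iff)
    have "x - e \<in> kernel_code h n"
      using x e words_support[OF e(1) I(1)]
      by (simp add: kernel_code_def syndrome_simps wordvs.subspace_diff[OF subspace_words])
    moreover have "hamming_dist n x (x - e) \<le> card I"
      unfolding hamming_dist_def using e I
      by (intro card_mono) (auto intro: finite_subset)
    ultimately show "\<exists>c\<in>kernel_code h n. hamming_dist n x c \<le> R"
      using I by (meson order.trans)
  qed
qed

text \<open>The fibres of the surjective syndrome map are translates of the kernel, one for each of
  the \<open>CARD('a) ^ 4\<close> syndromes.\<close>

lemma card_kernel_code:
  fixes h :: "nat \<Rightarrow> 'a::{field,finite} ^ 4"
  assumes surj: "syndrome h n ` words n = UNIV"
  shows "card (kernel_code h n) * CARD('a) ^ 4 = CARD('a) ^ n"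
proof -
  have fibre: "card {x \<in> words n. syndrome h n x = v} = card (kernel_code h n)" for v
  proof -
    obtain x0 where x0: "x0 \<in> words n" "syndrome h n x0 = v"
      using surj by (metis UNIV_I imageE)
    have "bij_betw (\<lambda>c. x0 + c) (kernel_code h n) {x \<in> words n. syndrome h n x = v}"
      using x0 wordvs.subspace_add[OF subspace_words] wordvs.subspace_diff[OF subspace_words]
      by (intro bij_betwI[where g = "\<lambda>x. x - x0"]) (auto simp: kernel_code_def syndrome_simps)
    then show ?thesis
      by (rule bij_betw_same_card[symmetric])
  qed
  have "card (words n :: (nat \<Rightarrow> 'a) set) = card (\<Union>v\<in>UNIV. {x \<in> words n. syndrome h n x = v})"
    by (intro arg_cong[of _ _ card]) auto
  also have "\<dots> = (\<Sum>v\<in>UNIV. card {x \<in> words n. syndrome h n x = v})"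
    by (intro card_UN_disjoint) (auto intro: finite_subset[OF _ finite_words])
  finally show ?thesis
    by (simp add: fibre card_words mult.commute)
qed

lemma linear_code_kernel_code:
  fixes h :: "nat \<Rightarrow> 'a::{field,finite} ^ 4"
  assumes surj: "syndrome h n ` words n = UNIV"
  shows "4 \<le> n" "linear_code n (n - 4) (kernel_code h n)"
proof -
  have sub: "kernel_code h n \<subseteq> words n"
    by (auto simp: kernel_code_def)
  have "card (kernel_code h n) = CARD('a) ^ wordvs.dim (kernel_code h n)"
    using sub by (intro wordvs.card_subspace subspace_kernel_code) (rule finite_subset[OF _ finite_words])
  then have "CARD('a) ^ (wordvs.dim (kernel_code h n) + 4) = CARD('a) ^ n"
    using card_kernel_code[OF surj] by (simp add: power_add)
  \<comment> \<open>A field has at least two elements, so exponents can be compared.\<close>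
  moreover have "card {0, 1 :: 'a} \<le> CARD('a)"
    by (intro card_mono) auto
  ultimately have "wordvs.dim (kernel_code h n) + 4 = n"
    by (subst (asm) power_inject_exp) auto
  then show "4 \<le> n" "linear_code n (n - 4) (kernel_code h n)"
    using sub subspace_kernel_code by (auto simp: linear_code_def)
qed

lemma columns_cover_mono:
  "columns_cover h n R \<Longrightarrow> R \<le> R' \<Longrightarrow> columns_cover h n R'"
  unfolding columns_cover_def by (meson order.trans)

text \<open>The spans of the \<open>n\<^sup>2\<close> pairs of columns have at most
  \<open>q\<^sup>2\<close> vectors each and must contain all \<open>q ^ 4\<close> vectors.\<close>

lemma columns_cover_2_imp_le:
  fixes h :: "nat \<Rightarrow> 'a::{field,finite} ^ 4"
  assumes "columns_cover h n 2"
  shows "CARD('a) \<le> n"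
proof (cases "n = 0")
  case True
  then have "v = 0" for v :: "'a ^ 4"
    using assms by (auto simp: columns_cover_def)
  then have "axis 1 1 = (0 :: 'a ^ 4)"
    by blast
  then show ?thesis
    by (simp add: axis_eq_0_iff)
next
  case False
  have "v \<in> (\<Union>(i, j)\<in>{..<n} \<times> {..<n}. vec.span {h i, h j})" for v
  proof -
    obtain I where I: "I \<subseteq> {..<n}" "card I \<le> 2" "v \<in> vec.span (h ` I)"
      using assms by (auto simp: columns_cover_def)
    \<comment> \<open>Smaller index sets are padded to a pair; \<open>i = j\<close> handles
      \<open>n = 1\<close>.\<close>
    have "\<exists>i<n. \<exists>j<n. I \<subseteq> {i, j}"
    proof -
      have "2 \<le> card {..<n} \<or> n = 1"
        using False by auto
      then show ?thesis
      proof
        assume "n = 1"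
        then show ?thesis using I by auto
      next
        assume "2 \<le> card {..<n}"
        then obtain J where "I \<subseteq> J" "J \<subseteq> {..<n}" "card J = 2"
          using exists_subset_between[of I 2 "{..<n}"] I by auto
        then show ?thesis
          by (auto simp: card_2_iff)
      qed
    qed
    then obtain i j where ij: "i < n" "j < n" "I \<subseteq> {i, j}"
      by blast
    then have "h ` I \<subseteq> {h i, h j}"
      by auto
    then show ?thesis
      using I(3) ij vec.span_mono[of "h ` I" "{h i, h j}"] by blast
  qed
  then have "UNIV = (\<Union>(i, j)\<in>{..<n} \<times> {..<n}. vec.span {h i, h j})"
    by auto
  then have "CARD('a ^ 4) = card (\<Union>(i, j)\<in>{..<n} \<times> {..<n}. vec.span {h i, h j})"
    by simp
  also have "\<dots> \<le> (\<Sum>(i, j)\<in>{..<n} \<times> {..<n}. card (vec.span {h i, h j}))"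
    by (rule order.trans[OF card_UN_le]) (auto simp: case_prod_beta)
  also have "\<dots> \<le> (\<Sum>(i, j)\<in>{..<n} \<times> {..<n}. CARD('a) ^ 2)"
  proof (rule sum_mono, clarify)
    fix i j
    have "card {h i, h j} \<le> 2"
      by (simp add: card_insert_if)
    then show "card (vec.span {h i, h j}) \<le> CARD('a) ^ 2"
      by (intro order.trans[OF card_vec_span_le] power_increasing) auto
  qed
  also have "\<dots> = n ^ 2 * CARD('a) ^ 2"
    by (simp add: power2_eq_square)
  finally have "CARD('a) ^ 2 * CARD('a) ^ 2 \<le> n ^ 2 * CARD('a) ^ 2"
    by (simp add: power_add[symmetric])
  then have "CARD('a) ^ 2 \<le> n ^ 2"
    by (subst (asm) mult_le_cancel2) simp
  then show ?thesis
    by (simp only: power2_nat_le_eq_le)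
qed

text \<open>The length is below \<open>CARD('a)\<close>, so two columns do not always suffice and
  the covering radius is exactly 3, not merely at most 3.\<close>

lemma code_of_columns:
  fixes h :: "nat \<Rightarrow> 'a::{field,finite} ^ 4"
  assumes cov: "columns_cover h n 3" and small: "n < CARD('a)"
  shows "4 \<le> n \<and> (\<exists>C :: (nat \<Rightarrow> 'a) set. linear_code n (n - 4) C \<and> covering_radius n C = 3)"
proof -
  have surj: "syndrome h n ` words n = UNIV"
    using cov by (rule columns_cover_imp_surj)
  have "covering_radius n (kernel_code h n) = 3"
    unfolding covering_radius_def kernel_covering_iff[OF surj]
  proof (rule Least_equality)
    fix R assume R: "columns_cover h n R"
    show "3 \<le> R"
    proof (rule ccontr)
      assume "\<not> 3 \<le> R"
      then have "columns_cover h n 2"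
        by (intro columns_cover_mono[OF R]) auto
      then show False
        using columns_cover_2_imp_le small by fastforce
    qed
  qed (rule cov)
  then show ?thesis
    using linear_code_kernel_code[OF surj] by auto
qed

interpretation words_to_vec: vector_space_pair
  "\<lambda>(c :: 'a::field) (x :: nat \<Rightarrow> 'a) i. c * x i" "(*s) :: 'a \<Rightarrow> 'a ^ 4 \<Rightarrow> 'a ^ 4"
  by unfold_locales

lemma words_unit_sum:
  assumes "x \<in> words n"
  shows "x = (\<Sum>i<n. (\<lambda>j. x i * (if j = i then 1 else 0)))"
proof
  fix j
  have "(\<Sum>i<n. (\<lambda>j. x i * (if j = i then 1 else 0))) j = (\<Sum>i<n. x i * (if j = i then 1 else 0))"
    by (induction n) auto
  also have "\<dots> = (\<Sum>i<n. if i = j then x j else 0)"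
    by (intro sum.cong) auto
  also have "\<dots> = x j"
    using assms by (auto simp: words_def)
  finally show "x j = (\<Sum>i<n. (\<lambda>j. x i * (if j = i then 1 else 0))) j" ..
qed

text \<open>A basis of \<open>C\<close> is extended to one of all words. The linear map that kills
  the basis of \<open>C\<close> and sends the four new vectors to the unit vectors is a syndrome map
  whose columns are the images of the unit words.\<close>

lemma parity_check:
  fixes C :: "(nat \<Rightarrow> 'a::{field,finite}) set"
  assumes C: "linear_code n (n - 4) C" and n: "4 \<le> n"
  shows "\<exists>h :: nat \<Rightarrow> 'a ^ 4. syndrome h n ` words n = UNIV \<and> kernel_code h n = C"
proof -
  have CW: "C \<subseteq> words n" and subC: "wordvs.subspace C" and dimC: "wordvs.dim C = n - 4"
    using C by (auto simp: linear_code_def)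
  have q: "1 < CARD('a)"
    using card_mono[of "UNIV :: 'a set" "{0, 1}"] by simp
  obtain B where B: "B \<subseteq> C" "wordvs.independent B" "C \<subseteq> wordvs.span B" "card B = n - 4"
    using wordvs.basis_exists dimC by metis
  have finC: "finite C"
    using CW finite_words by (rule finite_subset)
  obtain B' where B': "B \<subseteq> B'" "B' \<subseteq> words n" "wordvs.independent B'" "words n \<subseteq> wordvs.span B'"
    using wordvs.maximal_independent_subset_extend[of B "words n"] B CW by blast
  have finB': "finite B'"
    using B'(2) finite_words by (rule finite_subset)
  have spanB': "wordvs.span B' = words n"
    using B' subspace_words by (intro equalityI wordvs.span_minimal)
  have "CARD('a) ^ card B' = CARD('a) ^ n"
    using wordvs.card_span[OF finB' B'(3)] spanB' card_words by metis
  then have "card B' = n"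
    using q by simp
  then have "card (B' - B) = card (cart_basis :: ('a ^ 4) set)"
    using B B' finB' n by (simp add: card_Diff_subset finite_subset card_cart_basis)
  then obtain f where f: "bij_betw f (B' - B) (cart_basis :: ('a ^ 4) set)"
    using finite_same_card_bij[OF finite_Diff[OF finB'] finite_cart_basis] by blast
  obtain g where g: "Vector_Spaces.linear (\<lambda>c x i. c * x i) (*s) g"
      "\<forall>x\<in>B'. g x = (if x \<in> B then 0 else f x)"
    using words_to_vec.linear_independent_extend[OF B'(3), of "\<lambda>x. if x \<in> B then 0 else f x"]
    by blast
  interpret g: Vector_Spaces.linear "\<lambda>c x i. c * x i" "(*s)" g
    by (rule g(1))
  define h where "h i = g (\<lambda>j. if j = i then 1 else 0)" for i
  have syn: "syndrome h n x = g x" if "x \<in> words n" for x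
  proof -
    have "g x = (\<Sum>i<n. g (\<lambda>j. x i * (if j = i then 1 else 0)))"
      by (subst words_unit_sum[OF that]) (rule g.sum)
    also have "\<dots> = syndrome h n x"
      unfolding syndrome_def h_def by (intro sum.cong refl) (rule g.scale)
    finally show ?thesis ..
  qed
  have "cart_basis \<subseteq> g ` words n"
  proof
    fix b :: "'a ^ 4" assume "b \<in> cart_basis"
    then have "b \<in> f ` (B' - B)"
      using bij_betw_imp_surj_on[OF f] by simp
    then obtain x where "b = f x" "x \<in> B' - B" ..
    then show "b \<in> g ` words n"
      using g(2) B'(2) by (intro image_eqI[of _ _ x]) auto
  qed
  then have "vec.span cart_basis \<subseteq> g ` words n"
    using g.subspace_image[OF subspace_words] by (rule vec.span_minimal)
  moreover have "syndrome h n ` words n = g ` words n"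
    by (rule image_cong[OF refl syn])
  ultimately have surj: "syndrome h n ` words n = UNIV"
    unfolding span_cart_basis by (simp only: top.extremum_unique)
  have "B \<subseteq> kernel_code h n"
  proof
    fix x assume x: "x \<in> B"
    then have "x \<in> B'" "x \<in> words n"
      using B' by auto
    then show "x \<in> kernel_code h n"
      using g(2) syn x by (simp add: kernel_code_def)
  qed
  then have "wordvs.span B \<subseteq> kernel_code h n"
    using subspace_kernel_code by (rule wordvs.span_minimal)
  with B have sub: "C \<subseteq> kernel_code h n"
    by blast
  \<comment> \<open>Equality with \<open>C\<close> follows by counting, since \<open>C\<close> is
    contained in the kernel.\<close>
  have "card (kernel_code h n) * CARD('a) ^ 4 = CARD('a) ^ (n - 4) * CARD('a) ^ 4"
    using card_kernel_code[OF surj] n by (simp add: power_add[symmetric])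
  also have "CARD('a) ^ (n - 4) = card C"
    using wordvs.card_subspace[OF subC finC] dimC by simp
  finally have "card (kernel_code h n) = card C"
    by simp
  moreover have "finite (kernel_code h n)"
    by (rule finite_subset[OF _ finite_words]) (auto simp: kernel_code_def)
  ultimately have "kernel_code h n = C"
    using card_subset_eq[OF _ sub] by simp
  with surj show ?thesis
    by blast
qed

lemma columns_of_code:
  fixes C :: "(nat \<Rightarrow> 'a::{field,finite}) set"
  assumes C: "linear_code n (n - 4) C" and n: "4 \<le> n" and R: "covering_radius n C = R"
  shows "\<exists>h :: nat \<Rightarrow> 'a ^ 4. columns_cover h n R"
proof -
  obtain h :: "nat \<Rightarrow> 'a ^ 4" where h: "syndrome h n ` words n = UNIV" "kernel_code h n = C"
    using parity_check[OF C n] by blast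
  let ?P = "\<lambda>R. \<forall>x\<in>words n. \<exists>c\<in>C. hamming_dist n x c \<le> R"
  \<comment> \<open>Every distance is at most \<open>n\<close> and \<open>C\<close> is nonempty, so
    the \<open>LEAST\<close> in \<open>covering_radius\<close> is attained.\<close>
  have "0 \<in> C"
    using C by (auto simp: linear_code_def dest: wordvs.subspace_0)
  moreover have "hamming_dist n x c \<le> n" for x c :: "nat \<Rightarrow> 'a"
    unfolding hamming_dist_def using card_mono[of "{..<n}" "{i. i < n \<and> x i \<noteq> c i}"] by auto
  ultimately have "?P n"
    by blast
  then have "?P R"
    unfolding R[symmetric] covering_radius_def by (rule LeastI)
  then show ?thesis
    using kernel_covering_iff[OF h(1), of R] h(2) by auto
qed

section \<open>From vectors to projective points and back\<close>

lemma pg_point_generator: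
  assumes "P \<in> pg_points"
  obtains v where "P \<subseteq> vec.span {v}"
proof -
  have "vec.dim P = 1"
    using assms by (simp add: pg_subspaces_def)
  moreover obtain B where B: "P \<subseteq> vec.span B" "card B = vec.dim P"
    by (rule vec.basis_exists)
  ultimately have "card B = 1"
    by simp
  then obtain v where "B = {v}"
    by (rule card_1_singletonE)
  with B(1) that show ?thesis
    by blast
qed

lemma span_singleton_in_pg_points: "v \<noteq> 0 \<Longrightarrow> vec.span {v} \<in> pg_points"
  by (simp add: pg_subspaces_def)

text \<open>Saturation asks for three non-collinear points, so a small or dependent \<open>T\<close>
  must be completed. The triple is chosen between a basis of \<open>span T\<close> and a basis of
  the whole space inside \<open>H\<close>.\<close>

lemma independent_triple:
  fixes H :: "('a::field ^ 4) set"
  assumes H: "vec.span H = UNIV" and T: "finite T" "T \<subseteq> H" "card T \<le> 3"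
  obtains E where "E \<subseteq> H" "vec.independent E" "card E = 3" "vec.span T \<subseteq> vec.span E"
proof -
  obtain T0 where T0: "T0 \<subseteq> T" "vec.independent T0" "T \<subseteq> vec.span T0"
    by (rule vec.maximal_independent_subset)
  have "T0 \<subseteq> H"
    using T0(1) T(2) by (rule subset_trans)
  then obtain D where D: "T0 \<subseteq> D" "D \<subseteq> H" "vec.independent D" "H \<subseteq> vec.span D"
    using T0(2) by (rule vec.maximal_independent_subset_extend)
  have "vec.span H \<subseteq> vec.span D"
    using D(4) by (rule vec.span_minimal) simp
  then have "vec.span D = vec.span UNIV"
    using H by auto
  then have "vec.dim (UNIV :: ('a ^ 4) set) = card D"
    using D(3) by (rule vec.dim_eq_card)
  then have "card D = 4"
    by (simp add: vec.dim_UNIV vec.dimension_def card_cart_basis)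
  moreover from this have "finite D"
    using card_ge_0_finite[of D] by simp
  moreover have "card T0 \<le> 3"
    using card_mono[OF T(1) T0(1)] T(3) by simp
  ultimately obtain E where E: "T0 \<subseteq> E" "E \<subseteq> D" "card E = 3"
    using exists_subset_between[of T0 3 D] D(1) by auto
  have "vec.independent E"
    using vec.independent_mono[OF D(3) E(2)] .
  moreover have "vec.span T \<subseteq> vec.span T0"
    using T0(3) by (rule vec.span_minimal) simp
  then have "vec.span T \<subseteq> vec.span E"
    using vec.span_mono[OF E(1)] by (rule subset_trans)
  ultimately show ?thesis
    using that E D(2) by (meson subset_trans)
qed

lemma not_collinear_points:
  assumes "vec.independent {a, b, c}" "card {a, b, c} = 3"
  shows "\<not> collinear_points {vec.span {a}, vec.span {b}, vec.span {c}}"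
proof
  assume "collinear_points {vec.span {a}, vec.span {b}, vec.span {c}}"
  then obtain L where "L \<in> pg_lines"
    and L: "vec.span {a} \<subseteq> L" "vec.span {b} \<subseteq> L" "vec.span {c} \<subseteq> L"
    unfolding collinear_points_def by blast
  then have dim: "vec.dim L = 2"
    by (simp add: pg_subspaces_def)
  have "{a, b, c} \<subseteq> L"
    using L vec.span_base[of a "{a}"] vec.span_base[of b "{b}"] vec.span_base[of c "{c}"] by blast
  then show False
    using vec.independent_card_le_dim[OF _ assms(1), of L] dim assms(2) by simp
qed

text \<open>Passing to points drops the zero vector and merges proportional vectors, so the size
  cannot grow.\<close>

lemma saturating_of_vectors:
  fixes H :: "('a::{field,finite} ^ 4) set"
  assumes cov: "\<And>v. \<exists>T\<subseteq>H. card T \<le> 3 \<and> v \<in> vec.span T"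
  shows "\<exists>S :: ('a ^ 4) set set. two_saturating S \<and> card S \<le> card H"
proof -
  define S where "S = (\<lambda>v. vec.span {v}) ` (H - {0})"
  have "v \<in> vec.span H" for v
  proof -
    obtain T where "T \<subseteq> H" "v \<in> vec.span T"
      using cov[of v] by blast
    then show ?thesis
      using vec.span_mono[of T H] by blast
  qed
  then have spanH: "vec.span H = UNIV"
    by blast
  have "\<exists>A\<in>S. \<exists>B\<in>S. \<exists>C\<in>S. \<not> collinear_points {A, B, C} \<and> P \<subseteq> vec.span (A \<union> B \<union> C)"
    if P: "P \<in> pg_points" for P
  proof -
    from P obtain v where v: "P \<subseteq> vec.span {v}"
      by (rule pg_point_generator)
    obtain T where T: "T \<subseteq> H" "card T \<le> 3" "v \<in> vec.span T"
      using cov[of v] by blast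
    obtain E where E: "E \<subseteq> H" "vec.independent E" "card E = 3" "vec.span T \<subseteq> vec.span E"
      using independent_triple[OF spanH finite T(1,2)] by blast
    obtain a b c where abc: "E = {a, b, c}"
      using E(3) unfolding card_3_iff by blast
    let ?M = "vec.span {a} \<union> vec.span {b} \<union> vec.span {c}"
    have "E \<subseteq> ?M"
      unfolding abc
      using vec.span_base[of a "{a}"] vec.span_base[of b "{b}"] vec.span_base[of c "{c}"] by blast
    then have "vec.span E \<subseteq> vec.span ?M"
      by (rule vec.span_mono)
    then have "{v} \<subseteq> vec.span ?M"
      using T(3) E(4) by blast
    then have "vec.span {v} \<subseteq> vec.span ?M"
      by (rule vec.span_minimal) (rule vec.subspace_span)
    with v have "P \<subseteq> vec.span ?M"
      by (rule subset_trans)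
    moreover have "\<not> collinear_points {vec.span {a}, vec.span {b}, vec.span {c}}"
      using E(2,3) unfolding abc by (rule not_collinear_points)
    moreover have "0 \<notin> E"
      using E(2) vec.dependent_zero[of E] by blast
    then have "vec.span {a} \<in> S" "vec.span {b} \<in> S" "vec.span {c} \<in> S"
      using E(1) unfolding abc S_def by blast+
    ultimately show ?thesis
      by blast
  qed
  moreover have "S \<subseteq> pg_points"
    unfolding S_def using span_singleton_in_pg_points by blast
  ultimately have "two_saturating S"
    by (simp add: two_saturating_def)
  moreover have "card S \<le> card H"
    unfolding S_def using card_image_le[of "H - {0}" "\<lambda>v. vec.span {v}"] card_Diff1_le[of H 0]
    by simp
  ultimately show ?thesis
    by blast
qed

lemma columns_of_saturating:
  fixes S :: "('a::{field,finite} ^ 4) set set"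
  assumes S: "two_saturating S"
  shows "\<exists>h :: nat \<Rightarrow> 'a ^ 4. columns_cover h (card S) 3"
proof -
  have "\<exists>v. P \<subseteq> vec.span {v}" if "P \<in> S" for P
  proof -
    have "P \<in> pg_points"
      using S that unfolding two_saturating_def by blast
    then obtain v where "P \<subseteq> vec.span {v}"
      by (rule pg_point_generator)
    then show ?thesis ..
  qed
  then have "\<forall>P\<in>S. \<exists>v. P \<subseteq> vec.span {v}"
    by blast
  then obtain gen where gen: "\<And>P. P \<in> S \<Longrightarrow> P \<subseteq> vec.span {gen P}"
    unfolding bchoice_iff by blast
  obtain e where "bij_betw e {0..<card S} S"
    using ex_bij_betw_nat_finite[OF finite] by blast
  then have e: "e ` {..<card S} = S"
    unfolding atLeast0LessThan by (rule bij_betw_imp_surj_on)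
  define h where "h i = gen (e i)" for i
  have "\<exists>I\<subseteq>{..<card S}. card I \<le> 3 \<and> v \<in> vec.span (h ` I)" for v
  proof (cases "v = 0")
    case True
    then show ?thesis
      by (intro exI[of _ "{}"]) simp
  next
    case False
    then have "vec.span {v} \<in> pg_points"
      by (rule span_singleton_in_pg_points)
    then obtain A B C where ABC: "A \<in> S" "B \<in> S" "C \<in> S" "vec.span {v} \<subseteq> vec.span (A \<union> B \<union> C)"
      using S unfolding two_saturating_def by fast
    have index: "\<exists>i. i < card S \<and> X = e i" if "X \<in> S" for X
    proof -
      have "X \<in> e ` {..<card S}"
        using that by (simp only: e)
      then show ?thesis
        by blast
    qed
    obtain i where i: "i < card S" "A = e i"
      using index[OF ABC(1)] by blast
    obtain j where j: "j < card S" "B = e j"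
      using index[OF ABC(2)] by blast
    obtain k where k: "k < card S" "C = e k"
      using index[OF ABC(3)] by blast
    let ?I = "{i, j, k}"
    have "A \<subseteq> vec.span {h i}" "B \<subseteq> vec.span {h j}" "C \<subseteq> vec.span {h k}"
      using gen[OF ABC(1)] gen[OF ABC(2)] gen[OF ABC(3)] unfolding h_def i j k by simp_all
    moreover have "vec.span {h i} \<subseteq> vec.span (h ` ?I)" "vec.span {h j} \<subseteq> vec.span (h ` ?I)"
      "vec.span {h k} \<subseteq> vec.span (h ` ?I)"
      by (rule vec.span_mono, simp)+
    ultimately have "A \<union> B \<union> C \<subseteq> vec.span (h ` ?I)"
      by blast
    then have "vec.span (A \<union> B \<union> C) \<subseteq> vec.span (h ` ?I)"
      by (rule vec.span_minimal) (rule vec.subspace_span)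
    then have "v \<in> vec.span (h ` ?I)"
      using ABC(4) vec.span_base[of v "{v}"] by blast
    moreover have "card ?I \<le> 3"
      by (simp add: card_insert_if)
    moreover have "?I \<subseteq> {..<card S}"
      using i j k by simp
    ultimately show ?thesis
      by blast
  qed
  then have "columns_cover h (card S) 3"
    unfolding columns_cover_def by (rule allI)
  then show ?thesis
    by (rule exI[of _ h])
qed

text \<open>A smallest saturating set has fewer than \<open>CARD('a)\<close> points, so its points
  form the columns of a code of covering radius exactly 3. Conversely, the columns of a shortest
  such code give a saturating set that is no larger than its length.\<close>

lemma saturating_number_eq_length_function:
  fixes S :: "('a::{field,finite} ^ 4) set set"
  assumes S: "two_saturating S" "card S < CARD('a)"
  shows "saturating_number TYPE('a) = length_function TYPE('a) 4 3"
    and "saturating_number TYPE('a) \<le> card S"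
proof -
  define s where "s = saturating_number TYPE('a)"
  define l where "l = length_function TYPE('a) 4 3"
  let ?Q = "\<lambda>n. \<exists>S :: ('a ^ 4) set set. two_saturating S \<and> card S = n"
  let ?L = "\<lambda>n. 4 \<le> n \<and> (\<exists>C :: (nat \<Rightarrow> 'a) set. linear_code n (n - 4) C \<and> covering_radius n C = 3)"
  have s: "s = (LEAST n. ?Q n)" and l: "l = (LEAST n. ?L n)"
    by (simp_all add: s_def l_def saturating_number_def length_function_def)
  have QS: "?Q (card S)"
    using S by blast
  have "?Q s"
    unfolding s using QS by (rule LeastI)
  then obtain S0 :: "('a ^ 4) set set" where S0: "two_saturating S0" "card S0 = s"
    by blast
  have le: "s \<le> card S"
    unfolding s using QS by (rule Least_le)
  then show "saturating_number TYPE('a) \<le> card S"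
    by (simp add: s_def)
  have "s < CARD('a)"
    using le S(2) by (rule order.strict_trans1)
  moreover obtain h :: "nat \<Rightarrow> 'a ^ 4" where "columns_cover h s 3"
    using columns_of_saturating[OF S0(1)] S0(2) by auto
  ultimately have Ls: "?L s"
    using code_of_columns by blast
  have "?L l"
    unfolding l using Ls by (rule LeastI)
  then obtain h' :: "nat \<Rightarrow> 'a ^ 4" where h': "columns_cover h' l 3"
    using columns_of_code by blast
  let ?H = "h' ` {..<l}"
  have "\<exists>T\<subseteq>?H. card T \<le> 3 \<and> v \<in> vec.span T" for v
  proof -
    obtain I where I: "I \<subseteq> {..<l}" "card I \<le> 3" "v \<in> vec.span (h' ` I)"
      using h' unfolding columns_cover_def by blast
    have "card (h' ` I) \<le> 3"
      using card_image_le[OF finite_subset[OF I(1)], of h'] I(2) by simp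
    then show ?thesis
      using I by blast
  qed
  then obtain S1 :: "('a ^ 4) set set" where S1: "two_saturating S1" "card S1 \<le> card ?H"
    using saturating_of_vectors by blast
  have "s \<le> card S1"
    unfolding s using S1 by (intro Least_le) blast
  also have "\<dots> \<le> l"
    using S1(2) card_image_le[of "{..<l}" h'] by simp
  finally have "s \<le> l" .
  moreover have "l \<le> s"
    unfolding l using Ls by (rule Least_le)
  ultimately show "saturating_number TYPE('a) = length_function TYPE('a) 4 3"
    by (simp add: s_def l_def)
qed


section \<open>The number of steps\<close>

lemma ln_gt_two: "\<V> < x \<Longrightarrow> 2 < ln x"
proof -
  assume x: "\<V> < x"
  have "exp (2 :: real) = exp 1 * exp 1"
    by (simp add: exp_add[symmetric])
  also have "\<dots> \<le> 3 * 3"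
    by (intro mult_mono exp_le) auto
  also have "\<dots> < x"
    using x by (simp add: \<V>_def)
  finally have "ln (exp 2) < ln x"
    by (rule ln_less_cancel_iff[THEN iffD2, rotated -1]) (use x in \<open>auto simp: \<V>_def\<close>)
  then show ?thesis
    by simp
qed

text \<open>The derivative is \<open>ln x * (2 - ln x) / x\<^sup>2\<close>, negative once
  \<open>ln x > 2\<close>.\<close>

lemma ln_squared_over_decreasing:
  assumes "\<V> < a" "a < b"
  shows "(ln b)\<^sup>2 / b < (ln a)\<^sup>2 / a"
proof (rule DERIV_neg_imp_decreasing[OF assms(2)])
  fix x assume "a \<le> x" "x \<le> b"
  then have x: "\<V> < x"
    using assms by simp
  then have "0 < x"
    by (simp add: \<V>_def)
  then have "((\<lambda>x. (ln x)\<^sup>2 / x) has_real_derivative ln x * (2 - ln x) / x\<^sup>2) (at x)"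
    by (auto intro!: derivative_eq_intros simp: field_simps power2_eq_square)
  moreover have "ln x * (2 - ln x) < 0"
    using ln_gt_two[OF x] by (intro mult_pos_neg) linarith+
  then have "ln x * (2 - ln x) / x\<^sup>2 < 0"
    using \<open>0 < x\<close> by (intro divide_neg_pos) auto
  ultimately show "\<exists>y. ((\<lambda>x. (ln x)\<^sup>2 / x) has_real_derivative y) (at x) \<and> y < 0"
    by blast
qed

lemma \<W>_properties:
  assumes "\<exists>w>\<V>. \<W>_equation k w"
  shows "\<V> < \<W> k" "\<W>_equation k (\<W> k)"
proof -
  have "\<exists>!w. \<V> < w \<and> \<W>_equation k w"
    using assms
  proof (rule_tac ex_ex1I)
    fix w w' assume "\<V> < w \<and> \<W>_equation k w" "\<V> < w' \<and> \<W>_equation k w'"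
    then show "w = w'"
      using ln_squared_over_decreasing[of w w'] ln_squared_over_decreasing[of w' w]
      by (cases w w' rule: linorder_cases) (auto simp: \<W>_equation_def)
  qed auto
  from theI'[OF this] show "\<V> < \<W> k" "\<W>_equation k (\<W> k)"
    by (simp_all add: \<W>_def)
qed

text \<open>Monotonicity turns the equation for \<open>\<W> k\<close> into an inequality at
  \<open>q\<close>. As \<open>t ^ 3 = k * q * ln q\<close>, the quantity
  \<open>k ^ 5 * (ln q)\<^sup>2 / q\<close> is the cube of \<open>k * t\<^sup>2 / q\<close>, so cube
  roots can be taken.\<close>

lemma threshold_bound:
  fixes k q t :: real
  assumes "18 < k" "\<exists>w>\<V>. \<W>_equation k w" "\<W> k \<le> q" and t: "t ^ 3 = k * q * ln q"
  shows "0.302 * k * t\<^sup>2 \<le> (k - 18) * q"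
proof -
  note W = \<W>_properties[OF assms(2)]
  have q: "\<V> < q" "0 < q"
    using W(1) assms(3) by (auto simp: \<V>_def)
  have "(ln q)\<^sup>2 / q \<le> (ln (\<W> k))\<^sup>2 / \<W> k"
    using ln_squared_over_decreasing[OF W(1), of q] assms(3) by (cases "q = \<W> k") auto
  also have "\<dots> = ((k - 18) / 0.302) ^ 3 * (1 / k ^ 5)"
    using W(2) by (simp add: \<W>_equation_def)
  finally have *: "k ^ 5 * ((ln q)\<^sup>2 / q) \<le> ((k - 18) / 0.302) ^ 3"
    using assms(1) by (simp add: field_simps)
  have "(k * t\<^sup>2 / q) ^ 3 = k ^ 3 * (t ^ 3)\<^sup>2 / q ^ 3"
    by (simp add: power_mult_distrib power_divide power_mult[symmetric] mult.commute)
  also have "\<dots> = k ^ 5 * ((ln q)\<^sup>2 / q)"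
    using q(2) unfolding t by (simp add: field_simps power_numeral_reduce)
  finally have "(k * t\<^sup>2 / q) ^ 3 \<le> ((k - 18) / 0.302) ^ 3"
    using * by simp
  then have "k * t\<^sup>2 / q \<le> (k - 18) / 0.302"
    by (rule power_mono_iff[THEN iffD1, rotated -1]) (use q assms(1) in auto)
  then show ?thesis
    using q(2) by (simp add: field_simps)
qed

section \<open>Closed form of the sum of rates\<close>

lemma real_choose_two: "real (n choose 2) = real n * (real n - 1) / 2"
proof (induction n)
  case (Suc n)
  have "Suc n choose 2 = n + (n choose 2)"
    by (simp add: numeral_2_eq_2)
  then show ?case
    using Suc by (simp add: field_simps)
qed simp

lemma rate_eq:
  "rate q w = real w * (real w - 1) * (4 * (q - 1) - (real w + 1) * (real w - 2)) / (8 * q\<^sup>2)"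
proof -
  have "real (w choose 2) * (q - 1) - real ((w choose 2) choose 2)
      = real w * (real w - 1) * (4 * (q - 1) - (real w + 1) * (real w - 2)) / 8"
    unfolding real_choose_two by (simp add: field_simps)
  then show ?thesis
    by (simp only: rate_def divide_divide_eq_left)
qed

text \<open>Summing \<open>j choose 2\<close> gives \<open>N choose 3 = (x ^ 3 - x) / 6\<close>, and
  summing \<open>3 * (j + 1 choose 4)\<close> gives
  \<open>3 * (N + 1 choose 5) = (x ^ 3 - x) * (x\<^sup>2 - 4) / 40\<close>; centring at
  \<open>x = N - 1\<close> makes both products symmetric. The terms \<open>- 4 * q + 7\<close>
  remove \<open>j = 2\<close> and \<open>j = 3\<close>.\<close>

lemma sum_rate:
  assumes "4 \<le> N" "q \<noteq> 0"
  defines "x \<equiv> real N - 1"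
  shows "(\<Sum>j=4..<N. rate q j) = ((x ^ 3 - x) * ((q - 1) / 6 - (x\<^sup>2 - 4) / 40) - 4 * q + 7) / q\<^sup>2"
  unfolding x_def using assms(1)
proof (induction N rule: dec_induct)
  case base
  show ?case
    using assms(2) by (simp add: field_simps)
next
  case (step N)
  define y where "y = real N"
  have "(\<Sum>j=4..<Suc N. rate q j) = (\<Sum>j=4..<N. rate q j) + rate q N"
    using step.hyps by simp
  also have "\<dots> = (((y - 1) ^ 3 - (y - 1)) * ((q - 1) / 6 - ((y - 1)\<^sup>2 - 4) / 40) - 4 * q + 7
      + y * (y - 1) * (4 * (q - 1) - (y + 1) * (y - 2)) / 8) / q\<^sup>2"
    unfolding step.IH rate_eq[of q N] y_def by (simp add: add_divide_distrib)
  also have "((y - 1) ^ 3 - (y - 1)) * ((q - 1) / 6 - ((y - 1)\<^sup>2 - 4) / 40) - 4 * q + 7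
      + y * (y - 1) * (4 * (q - 1) - (y + 1) * (y - 2)) / 8
      = (y ^ 3 - y) * ((q - 1) / 6 - (y\<^sup>2 - 4) / 40) - 4 * q + 7"
    by (simp add: field_simps power_numeral_reduce)
  finally show ?case
    by (simp add: y_def)
qed

section \<open>Estimates in the real parameters\<close>

locale threshold =
  fixes q t k :: real
  assumes k: "18 < k" and q: "\<V> < q"
    and t: "0 \<le> t" "t ^ 3 = k * q * ln q" "0.302 * k * t\<^sup>2 \<le> (k - 18) * q"
begin

lemma q_ge: "1000000 \<le> q"
  using q by (simp add: \<V>_def)

lemma cube_bounds: "18 * q \<le> t ^ 3" "18 * q\<^sup>2 * ln q \<le> t ^ 3 * (q - 0.302 * t\<^sup>2)"
proof -
  have ln: "1 \<le> ln q"
    using ln_gt_two[OF q] by simp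
  have "18 * q * 1 \<le> k * q * ln q"
    using k q_ge ln by (intro mult_mono) auto
  then show "18 * q \<le> t ^ 3"
    by (simp add: t)
  \<comment> \<open>This rearranges the third assumption on \<open>t\<close>; multiplying by
    \<open>q * ln q\<close> turns \<open>k\<close> into \<open>t ^ 3\<close>.\<close>
  have "18 * q \<le> k * (q - 0.302 * t\<^sup>2)"
    using t(3) by (simp add: algebra_simps)
  then have "(18 * q) * (q * ln q) \<le> k * (q - 0.302 * t\<^sup>2) * (q * ln q)"
    using q_ge ln by (intro mult_right_mono) auto
  then show "18 * q\<^sup>2 * ln q \<le> t ^ 3 * (q - 0.302 * t\<^sup>2)"
    unfolding t(2) by (simp add: power2_eq_square mult_ac)
qed

lemma t_ge: "100 \<le> t"
proof (rule ccontr)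
  assume "\<not> 100 \<le> t"
  then have "t ^ 3 \<le> 100 ^ 3"
    using t(1) by (intro power_mono) auto
  then show False
    using cube_bounds(1) q_ge by simp
qed

lemma t_squared_le: "t\<^sup>2 \<le> 3.32 * q"
proof -
  have "(k - 18) * q \<le> k * q"
    using q_ge by (intro mult_right_mono) auto
  then have "k * (0.302 * t\<^sup>2) \<le> k * q"
    using t(3) by (simp only: mult_ac)
  then have "0.302 * t\<^sup>2 \<le> q"
    using k by (subst (asm) mult_le_cancel_left_pos) auto
  then show ?thesis
    using q_ge by simp
qed

text \<open>Besides absorbing linear terms, this makes \<open>t + 2 < q\<close>, the smallness
  needed for covering radius exactly 3.\<close>

lemma t_le: "t \<le> 0.0332 * q"
proof -
  have "100 * t \<le> t * t"
    using t_ge by (intro mult_right_mono) auto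
  then show ?thesis
    using t_squared_le by (simp add: power2_eq_square)
qed

lemma rate_pos:
  assumes "4 \<le> j" "real j \<le> t + 1"
  shows "0 < rate q j"
proof -
  have "(real j + 1) * (real j - 2) \<le> (t + 2) * (t - 1)"
    using assms t_ge by (intro mult_mono) auto
  also have "\<dots> = t\<^sup>2 + t - 2"
    by (simp add: power2_eq_square algebra_simps)
  also have "\<dots> < 4 * (q - 1)"
    using t_squared_le t_le q_ge by simp
  finally show ?thesis
    unfolding rate_eq using assms q_ge by (intro divide_pos_pos mult_pos_pos) auto
qed

text \<open>Reducing \<open>q ^ 4\<close> vectors to fewer than \<open>q - 1\<close> takes a sum of
  rates a little above \<open>3 * ln q\<close>. The extra \<open>6 * q\<close> pays for the
  \<open>4 * q\<close> in \<open>sum_rate\<close> and for \<open>ln q - ln (q - 1)\<close>.\<close>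

lemma rate_sum_large:
  assumes x: "t \<le> x" "x \<le> t + 1"
  shows "3 * q\<^sup>2 * ln q + 6 * q < (x ^ 3 - x) * ((q - 1) / 6 - (x\<^sup>2 - 4) / 40)"
proof -
  \<comment> \<open>The last factor of the goal at \<open>x = t + 1\<close>, with its constant
    \<open>- 11 / 120\<close> rounded down to \<open>- 1 / 10\<close>.\<close>
  define b where "b = q / 6 - t\<^sup>2 / 40 - t / 20 - 1 / 10"
  have b_pos: "0 \<le> b"
    using t_squared_le t_le q_ge unfolding b_def by simp
  have b_le: "b \<le> q / 6"
    using t_ge zero_le_power2[of t] unfolding b_def by linarith
  have "x\<^sup>2 \<le> (t + 1)\<^sup>2"
    using x t_ge by (intro power_mono) auto
  then have b: "b \<le> (q - 1) / 6 - (x\<^sup>2 - 4) / 40"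
    by (simp add: b_def power2_eq_square field_simps)
  have "t * (t\<^sup>2 - 1) \<le> x * (x\<^sup>2 - 1)"
    using x t_ge one_le_power[of x 2] by (intro mult_mono diff_right_mono power_mono) auto
  then have x3: "t ^ 3 - t \<le> x ^ 3 - x"
    by (simp add: power_numeral_reduce algebra_simps)
  have t3: "0 \<le> t ^ 3 - t"
  proof -
    have "t ^ 1 \<le> t ^ 3"
      using t_ge by (intro power_increasing) auto
    then show ?thesis by simp
  qed
  have sq: "100 * t \<le> t\<^sup>2"
    using t_ge by (simp add: power2_eq_square)
  \<comment> \<open>Since \<open>0.302 / 6\<close> exceeds \<open>1 / 40 + 0.02\<close> by more than
    \<open>0.005\<close>, the quadratic surplus absorbs \<open>t / 20 + 1 / 10\<close>. The reserve
    \<open>0.02 * t\<^sup>2\<close> is kept for the remaining lower order terms.\<close>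
  have c: "(q - 0.302 * t\<^sup>2) / 6 + 0.02 * t\<^sup>2 \<le> b"
    using sq t_ge unfolding b_def by (simp add: field_simps)
  have "3 * q\<^sup>2 * ln q + t ^ 3 * (0.02 * t\<^sup>2) \<le> t ^ 3 * ((q - 0.302 * t\<^sup>2) / 6 + 0.02 * t\<^sup>2)"
    using cube_bounds(2) by (simp add: algebra_simps)
  also have "\<dots> \<le> t ^ 3 * b"
    using c t(1) by (intro mult_left_mono) auto
  also have "t ^ 3 * b \<le> (t ^ 3 - t) * b + t * (q / 6)"
    using mult_left_mono[OF b_le t(1)] by (simp add: algebra_simps)
  also have "(t ^ 3 - t) * b \<le> (x ^ 3 - x) * ((q - 1) / 6 - (x\<^sup>2 - 4) / 40)"
    using x3 b b_pos t3 by (intro mult_mono) auto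
  finally have main: "3 * q\<^sup>2 * ln q + t ^ 3 * (0.02 * t\<^sup>2)
      \<le> (x ^ 3 - x) * ((q - 1) / 6 - (x\<^sup>2 - 4) / 40) + t * (q / 6)"
    by simp
  \<comment> \<open>The reserve is worth at least \<open>36 * t * q\<close>, against the losses
    \<open>t * q / 6\<close> and \<open>6 * q\<close>.\<close>
  have "(18 * q) * (0.02 * (100 * t)) \<le> t ^ 3 * (0.02 * t\<^sup>2)"
    using cube_bounds(1) sq t_ge q_ge by (intro mult_mono) auto
  also have "(18 * q) * (0.02 * (100 * t)) = 36 * (t * q)"
    by simp
  finally have "36 * (t * q) \<le> t ^ 3 * (0.02 * t\<^sup>2)" .
  moreover have "100 * q \<le> t * q"
    using t_ge q_ge by (intro mult_right_mono) auto
  moreover have "t * (q / 6) = t * q / 6"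
    by simp
  ultimately show ?thesis
    using main q_ge by linarith
qed

lemma exp_sum_rate_less:
  assumes N: "t + 1 \<le> real N" "real N \<le> t + 2"
  shows "q ^ 4 * exp (- (\<Sum>j=4..<N. rate q j)) < q - 1"
proof -
  define x where "x = real N - 1"
  have x: "t \<le> x" "x \<le> t + 1"
    using N by (auto simp: x_def)
  have N4: "4 \<le> N"
    using N t_ge by linarith
  have "ln (q / (q - 1)) \<le> q / (q - 1) - 1"
    using q_ge by (intro ln_le_minus_one) auto
  also have "\<dots> = 1 / (q - 1)"
    using q_ge by (simp add: field_simps)
  also have "\<dots> \<le> 2 / q"
    using q_ge by (simp add: field_simps)
  finally have ln: "ln q - ln (q - 1) \<le> 2 / q"
    using q_ge by (simp add: ln_div)
  have "4 * ln q - ln (q - 1) \<le> 3 * ln q + 2 / q"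
    using ln by simp
  \<comment> \<open>Writing \<open>2 * q\<close> as \<open>6 * q - 4 * q\<close> matches
    \<open>rate_sum_large\<close> to the \<open>- 4 * q\<close> of \<open>sum_rate\<close>.\<close>
  also have "\<dots> = (3 * q\<^sup>2 * ln q + 6 * q - 4 * q) / q\<^sup>2"
    using q_ge by (simp add: field_simps power2_eq_square)
  also have "\<dots> < ((x ^ 3 - x) * ((q - 1) / 6 - (x\<^sup>2 - 4) / 40) - 4 * q + 7) / q\<^sup>2"
    using rate_sum_large[OF x] q_ge by (intro divide_strict_right_mono) auto
  also have "\<dots> = (\<Sum>j=4..<N. rate q j)"
    using sum_rate[OF N4, of q] q_ge by (simp add: x_def)
  finally have "exp (- (\<Sum>j=4..<N. rate q j)) < exp (ln (q - 1) - ln (q ^ 4))"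
    using q_ge by (simp add: ln_realpow)
  also have "\<dots> = (q - 1) / q ^ 4"
    using q_ge by (simp add: exp_diff)
  finally show ?thesis
    using q_ge by (simp add: field_simps)
qed

end

section \<open>The bound for the saturating number and the length function\<close>

theorem theorem3p4:
  fixes k :: real and q :: nat
  assumes "k > 18"
    and "\<exists>w > \<V>. \<W>_equation k w"
    and "\<W> k > \<V>"
    and "primepow q"
    and "CARD('a::{field,finite}) = q"
    and "int q \<ge> \<lceil>\<W> k\<rceil>"
  shows "saturating_number TYPE('a) = length_function TYPE('a) 4 3 \<and>
         real (length_function TYPE('a) 4 3) \<le> root 3 (k * real q * ln (real q)) + 2"
proof -
  define t where "t = root 3 (k * real q * ln (real q))"
  have card: "CARD('a) = q"
    by (rule assms(5))
  have Wq: "\<W> k \<le> real q"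
    using assms(6) by (simp add: ceiling_le_iff)
  have q: "\<V> < real q"
    using Wq assms(3) by simp
  have "0 \<le> k * real q * ln (real q)"
    using assms(1) ln_gt_two[OF q] by simp
  then have t: "0 \<le> t" "t ^ 3 = k * real q * ln (real q)"
    by (simp_all add: t_def)
  interpret threshold "real q" t k
    using assms(1) q t threshold_bound[OF assms(1,2) Wq t(2)] by unfold_locales
  \<comment> \<open>With this rounding \<open>N - 1\<close> is at least \<open>t\<close>, as the sum
    of rates requires, while \<open>N\<close> stays within the claimed \<open>t + 2\<close>.\<close>
  define N where "N = nat \<lfloor>t\<rfloor> + 2"
  have N: "t + 1 \<le> real N" "real N \<le> t + 2"
    using t(1) by (simp_all add: N_def) linarith+
  have N4: "4 \<le> N"
    using N t_ge by linarith
  have "0 < rate CARD('a) j" if "4 \<le> j" "j < N" for j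
    unfolding card using that N by (intro rate_pos) linarith+
  then obtain H :: "('a ^ 4) set" where H: "card H \<le> N"
    "uncovered H = {} \<or> card (uncovered H) \<le> CARD('a) ^ 4 * exp (- (\<Sum>j=4..<N. rate CARD('a) j))"
    using greedy[OF _ N4, where 'a = 'a] by blast
  have "uncovered H = {}"
  proof (rule ccontr)
    assume ne: "uncovered H \<noteq> {}"
    then have "real (card (uncovered H)) < real q - 1"
      using H(2) exp_sum_rate_less[OF N] by (simp add: card)
    then show False
      using card_uncovered_ge[OF ne] by (simp add: card)
  qed
  then have "\<exists>T\<subseteq>H. card T \<le> 3 \<and> v \<in> vec.span T" for v
    unfolding uncovered_def by blast
  then obtain S :: "('a ^ 4) set set" where S: "two_saturating S" "card S \<le> card H"
    using saturating_of_vectors by blast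
  have le: "real (card S) \<le> t + 2"
    using S(2) H(1) N by linarith
  then have "card S < CARD('a)"
    unfolding card using t_le q_ge by simp
  note eq = saturating_number_eq_length_function[OF S(1) this]
  have "real (length_function TYPE('a) 4 3) \<le> t + 2"
    using eq le by linarith
  then show ?thesis
    using eq(1) by (simp add: t_def)
qed

end
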